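(* Let $L$ be a finite-dimensional perfect diassociative algebra with free presentation $0\to R\to F\to L\to 0$. Then the extension $$E:0\to \frac{F'\cap R}{F\lozenge R+R\lozenge F}\to \frac{F'}{F\lozenge R+R\lozenge F}\to L\to 0,$$ whose first map is the inclusion and whose second map is induced by the restriction to $F'$ of the surjection $F\to L$, is universal.
   Context: All algebras are over a fixed field $\mathbb{F}$. A diassociative algebra is a vector space $L$ with two bilinear associative products $\dashv,\vdash$ satisfying, for all $x,y,z\in L$: $x\dashv(y\dashv z)=x\dashv(y\vdash z)$, $(x\vdash y)\dashv z=x\vdash(y\dashv z)$, $(x\dashv y)\vdash z=(x\vdash y)\vdash z$. Homomorphisms are linear maps preserving both products. For subalgebras $S,T$ of $L$, $S\lozenge T=S\dashv T+S\vdash T$ (linear span of all products $s\dashv t$ and $s\vdash t$). $L'=L\lozenge L$, and $L$ is perfect if $L=L'$. The center $Z(L)$ is the set of $z\in L$ with $z\dashv x=x\dashv z=z\vdash x=x\vdash z=0$ for all $x\in L$. A free presentation of $L$ is a short exact sequence $0\to R\to F\to L\to 0$ of diassociative algebras with $F$ a free diassociative algebra and $R\to F$ the inclusion of the kernel; $F\lozenge R+R\lozenge F$ is an ideal of $F$. An extension of $A$ by $L$ is a short exact sequence $0\to A\to H\xrightarrow{\phi} L\to 0$ of diassociative algebras and homomorphisms, where the map $A\to H$ is taken to be the inclusion (so $A=\ker\phi$). It is central if $A\subseteq Z(H)$; it is then called a central extension of $L$. A central extension $E:0\to A\to H\xrightarrow{\phi} L\to 0$ covers a central extension $E_1:0\to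 A_1\to H_1\xrightarrow{\phi_1} L\to 0$ if there is a homomorphism $\tau:H\to H_1$ making the diagram with vertical maps $\tau|_A,\tau,\mathrm{id}_L$ commute (i.e. $\phi_1\circ\tau=\phi$); it uniquely covers $E_1$ if moreover such $\tau$ is unique. A central extension $E$ of $L$ is universal if it uniquely covers every central extension of $L$. *)

theory Defs
  imports "HOL-Algebra.Module" "HOL-Algebra.QuotRing" "HOL.Hull"
begin

section \<open>Diassociative algebras\<close>

text \<open>As for modules in HOL-Algebra, the inherited fields \<open>mult\<close> and \<open>one\<close> carry no meaning;
  the two products are the new fields.\<close>

record ('k, 'a) dialgebra = "('k, 'a) module" +
  lprod :: "['a, 'a] \<Rightarrow> 'a" (infixl "\<stileturn>\<index>" 70)
  rprod :: "['a, 'a] \<Rightarrow> 'a" (infixl "\<turnstile>\<index>" 70)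

definition bilinear_product ::
  "('k, 'm) ring_scheme \<Rightarrow> ('k, 'a, 'n) module_scheme \<Rightarrow> ('a \<Rightarrow> 'a \<Rightarrow> 'a) \<Rightarrow> bool"
  where "bilinear_product K M p \<longleftrightarrow>
    (\<forall>x\<in>carrier M. \<forall>y\<in>carrier M. p x y \<in> carrier M) \<and>
    (\<forall>x\<in>carrier M. \<forall>y\<in>carrier M. \<forall>z\<in>carrier M.
       p (x \<oplus>\<^bsub>M\<^esub> y) z = p x z \<oplus>\<^bsub>M\<^esub> p y z \<and>
       p x (y \<oplus>\<^bsub>M\<^esub> z) = p x y \<oplus>\<^bsub>M\<^esub> p x z) \<and>
    (\<forall>c\<in>carrier K. \<forall>x\<in>carrier M. \<forall>y\<in>carrier M.
       p (c \<odot>\<^bsub>M\<^esub> x) y = c \<odot>\<^bsub>M\<^esub> p x y \<and>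
       p x (c \<odot>\<^bsub>M\<^esub> y) = c \<odot>\<^bsub>M\<^esub> p x y)"

locale diassociative_algebra = field K + module K D
  for K :: "('k, 'm) ring_scheme" and D :: "('k, 'a, 'n) dialgebra_scheme" (structure) +
  assumes lprod_bilinear: "bilinear_product K D (lprod D)"
    and rprod_bilinear: "bilinear_product K D (rprod D)"
    and lprod_assoc: "\<lbrakk>x \<in> carrier D; y \<in> carrier D; z \<in> carrier D\<rbrakk> \<Longrightarrow>
      (x \<stileturn> y) \<stileturn> z = x \<stileturn> (y \<stileturn> z)"
    and rprod_assoc: "\<lbrakk>x \<in> carrier D; y \<in> carrier D; z \<in> carrier D\<rbrakk> \<Longrightarrow>
      (x \<turnstile> y) \<turnstile> z = x \<turnstile> (y \<turnstile> z)"
    and lprod_lprod_rprod: "\<lbrakk>x \<in> carrier D; y \<in> carrier D; z \<in> carrier D\<rbrakk> \<Longrightarrow>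
      x \<stileturn> (y \<stileturn> z) = x \<stileturn> (y \<turnstile> z)"
    and rprod_lprod: "\<lbrakk>x \<in> carrier D; y \<in> carrier D; z \<in> carrier D\<rbrakk> \<Longrightarrow>
      (x \<turnstile> y) \<stileturn> z = x \<turnstile> (y \<stileturn> z)"
    and lprod_rprod_rprod: "\<lbrakk>x \<in> carrier D; y \<in> carrier D; z \<in> carrier D\<rbrakk> \<Longrightarrow>
      (x \<stileturn> y) \<turnstile> z = (x \<turnstile> y) \<turnstile> z"

definition dihom ::
  "('k, 'm) ring_scheme \<Rightarrow> ('k, 'a, 'n) dialgebra_scheme \<Rightarrow> ('k, 'b, 'p) dialgebra_scheme
    \<Rightarrow> ('a \<Rightarrow> 'b) set"
  where "dihom K D E = {f \<in> carrier D \<rightarrow> carrier E.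
    (\<forall>x\<in>carrier D. \<forall>y\<in>carrier D.
       f (x \<oplus>\<^bsub>D\<^esub> y) = f x \<oplus>\<^bsub>E\<^esub> f y \<and>
       f (x \<stileturn>\<^bsub>D\<^esub> y) = f x \<stileturn>\<^bsub>E\<^esub> f y \<and>
       f (x \<turnstile>\<^bsub>D\<^esub> y) = f x \<turnstile>\<^bsub>E\<^esub> f y) \<and>
    (\<forall>c\<in>carrier K. \<forall>x\<in>carrier D. f (c \<odot>\<^bsub>D\<^esub> x) = c \<odot>\<^bsub>E\<^esub> f x)}"

definition linear_span ::
  "('k, 'm) ring_scheme \<Rightarrow> ('k, 'a, 'n) module_scheme \<Rightarrow> 'a set \<Rightarrow> 'a set"
  where "linear_span K M S = (\<lambda>N. submodule N K M) hull S"

definition finite_dimensional ::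
  "('k, 'm) ring_scheme \<Rightarrow> ('k, 'a, 'n) module_scheme \<Rightarrow> bool"
  where "finite_dimensional K M \<longleftrightarrow>
    (\<exists>B. finite B \<and> B \<subseteq> carrier M \<and> linear_span K M B = carrier M)"

definition lozenge ::
  "('k, 'm) ring_scheme \<Rightarrow> ('k, 'a, 'n) dialgebra_scheme \<Rightarrow> 'a set \<Rightarrow> 'a set \<Rightarrow> 'a set"
  where "lozenge K D S T = linear_span K D
    ({s \<stileturn>\<^bsub>D\<^esub> t | s t. s \<in> S \<and> t \<in> T} \<union> {s \<turnstile>\<^bsub>D\<^esub> t | s t. s \<in> S \<and> t \<in> T})"

definition derived_algebra ::
  "('k, 'm) ring_scheme \<Rightarrow> ('k, 'a, 'n) dialgebra_scheme \<Rightarrow> 'a set"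
  where "derived_algebra K D = lozenge K D (carrier D) (carrier D)"

definition perfect ::
  "('k, 'm) ring_scheme \<Rightarrow> ('k, 'a, 'n) dialgebra_scheme \<Rightarrow> bool"
  where "perfect K D \<longleftrightarrow> carrier D = derived_algebra K D"

definition center :: "('k, 'a, 'n) dialgebra_scheme \<Rightarrow> 'a set"
  where "center D = {z \<in> carrier D. \<forall>x\<in>carrier D.
    z \<stileturn>\<^bsub>D\<^esub> x = \<zero>\<^bsub>D\<^esub> \<and> x \<stileturn>\<^bsub>D\<^esub> z = \<zero>\<^bsub>D\<^esub> \<and>
    z \<turnstile>\<^bsub>D\<^esub> x = \<zero>\<^bsub>D\<^esub> \<and> x \<turnstile>\<^bsub>D\<^esub> z = \<zero>\<^bsub>D\<^esub>}"

text \<open>The quotient by an ideal \<open>I\<close>, with the same coset operations as \<^const>\<open>FactRing\<close>.\<close>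

definition quotient_dialgebra ::
  "('k, 'a, 'n) dialgebra_scheme \<Rightarrow> 'a set \<Rightarrow> ('k, 'a set) dialgebra" (infixl "DQuot" 65)
  where "D DQuot I =
    \<lparr>carrier = a_rcosets\<^bsub>D\<^esub> I,
     monoid.mult = undefined,
     monoid.one = undefined,
     ring.zero = I,
     add = set_add D,
     smult = (\<lambda>c U. \<Union>u\<in>U. I +>\<^bsub>D\<^esub> (c \<odot>\<^bsub>D\<^esub> u)),
     lprod = (\<lambda>U V. \<Union>u\<in>U. \<Union>v\<in>V. I +>\<^bsub>D\<^esub> (u \<stileturn>\<^bsub>D\<^esub> v)),
     rprod = (\<lambda>U V. \<Union>u\<in>U. \<Union>v\<in>V. I +>\<^bsub>D\<^esub> (u \<turnstile>\<^bsub>D\<^esub> v))\<rparr>"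


section \<open>Extensions\<close>

text \<open>The short exact sequence \<open>0 \<rightarrow> A \<rightarrow> H \<rightarrow> L \<rightarrow> 0\<close> whose first map is the inclusion of the
  subset \<open>A\<close> of \<open>H\<close>, which carries the operations of \<open>H\<close>.\<close>

definition extension ::
  "('k, 'm) ring_scheme \<Rightarrow> 'a set \<Rightarrow> ('k, 'a, 'n) dialgebra_scheme \<Rightarrow> ('a \<Rightarrow> 'b)
    \<Rightarrow> ('k, 'b, 'p) dialgebra_scheme \<Rightarrow> bool"
  where "extension K A H \<phi> L \<longleftrightarrow>
    diassociative_algebra K H \<and> diassociative_algebra K L \<and>
    \<phi> \<in> dihom K H L \<and> \<phi> ` carrier H = carrier L \<and> A = a_kernel H L \<phi>"

definition central_extension ::
  "('k, 'm) ring_scheme \<Rightarrow> 'a set \<Rightarrow> ('k, 'a, 'n) dialgebra_scheme \<Rightarrow> ('a \<Rightarrow> 'b)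
    \<Rightarrow> ('k, 'b, 'p) dialgebra_scheme \<Rightarrow> bool"
  where "central_extension K A H \<phi> L \<longleftrightarrow> extension K A H \<phi> L \<and> A \<subseteq> center H"

text \<open>The homomorphisms making the diagram from \<open>0 \<rightarrow> A \<rightarrow> H \<rightarrow> L \<rightarrow> 0\<close> to
  \<open>0 \<rightarrow> A1 \<rightarrow> H1 \<rightarrow> L \<rightarrow> 0\<close> with the identity on \<open>L\<close> commute. Restricting to
  \<^const>\<open>extensional\<close> functions makes equality of HOL functions coincide with equality of maps
  on \<open>H\<close>.\<close>

definition covering_maps ::
  "('k, 'm) ring_scheme \<Rightarrow> 'a set \<Rightarrow> ('k, 'a, 'n) dialgebra_scheme \<Rightarrow> ('a \<Rightarrow> 'b)
    \<Rightarrow> 'c set \<Rightarrow> ('k, 'c, 'p) dialgebra_scheme \<Rightarrow> ('c \<Rightarrow> 'b) \<Rightarrow> ('a \<Rightarrow> 'c) set"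
  where "covering_maps K A H \<phi> A1 H1 \<phi>1 = {\<tau> \<in> dihom K H H1 \<inter> extensional (carrier H).
    \<tau> ` A \<subseteq> A1 \<and> (\<forall>h\<in>carrier H. \<phi>1 (\<tau> h) = \<phi> h)}"

definition uniquely_covers ::
  "('k, 'm) ring_scheme \<Rightarrow> 'a set \<Rightarrow> ('k, 'a, 'n) dialgebra_scheme \<Rightarrow> ('a \<Rightarrow> 'b)
    \<Rightarrow> 'c set \<Rightarrow> ('k, 'c, 'p) dialgebra_scheme \<Rightarrow> ('c \<Rightarrow> 'b) \<Rightarrow> bool"
  where "uniquely_covers K A H \<phi> A1 H1 \<phi>1 \<longleftrightarrow> (\<exists>!\<tau>. \<tau> \<in> covering_maps K A H \<phi> A1 H1 \<phi>1)"

text \<open>HOL formulas cannot quantify over types, so the two notions below that refer to all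
  diassociative algebras take the type \<open>'h\<close> of the elements of those algebras as an argument.
  A theorem in which \<open>'h\<close> is a type variable holds for all of them.\<close>

definition universal_extension ::
  "'h itself \<Rightarrow> ('k, 'm) ring_scheme \<Rightarrow> 'a set \<Rightarrow> ('k, 'a, 'n) dialgebra_scheme \<Rightarrow> ('a \<Rightarrow> 'b)
    \<Rightarrow> ('k, 'b, 'p) dialgebra_scheme \<Rightarrow> bool"
  where "universal_extension _ K A H \<phi> L \<longleftrightarrow>
    central_extension K A H \<phi> L \<and>
    (\<forall>(A1 :: 'h set) (H1 :: ('k, 'h) dialgebra) \<phi>1.
       central_extension K A1 H1 \<phi>1 L \<longrightarrow> uniquely_covers K A H \<phi> A1 H1 \<phi>1)"


section \<open>Free presentations\<close>

text \<open>Freeness on a set \<open>X\<close> of generators, by the universal property. An algebra that is free in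
  the usual sense satisfies this for every \<open>'h\<close>.\<close>

definition free_dialgebra ::
  "'h itself \<Rightarrow> ('k, 'm) ring_scheme \<Rightarrow> ('k, 'a, 'n) dialgebra_scheme \<Rightarrow> bool"
  where "free_dialgebra _ K F \<longleftrightarrow>
    diassociative_algebra K F \<and>
    (\<exists>X \<subseteq> carrier F. \<forall>(D :: ('k, 'h) dialgebra) f.
       diassociative_algebra K D \<and> f \<in> X \<rightarrow> carrier D \<longrightarrow>
       (\<exists>!g. g \<in> dihom K F D \<inter> extensional (carrier F) \<and> (\<forall>x\<in>X. g x = f x)))"

definition free_presentation ::
  "'h itself \<Rightarrow> ('k, 'm) ring_scheme \<Rightarrow> 'a set \<Rightarrow> ('k, 'a, 'n) dialgebra_scheme \<Rightarrow> ('a \<Rightarrow> 'b)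
    \<Rightarrow> ('k, 'b, 'p) dialgebra_scheme \<Rightarrow> bool"
  where "free_presentation T K R F \<pi> L \<longleftrightarrow> free_dialgebra T K F \<and> extension K R F \<pi> L"

end

theory Submission
  imports Defs
begin

text \<open>
  Put \<open>I = F \<lozenge> R + R \<lozenge> F\<close> and \<open>H = F'/I\<close>. Since \<open>L\<close> is perfect, \<open>F'\<close> still maps onto \<open>L\<close>, so \<open>H\<close> is an
  extension of \<open>L\<close> by \<open>(F' \<inter> R)/I\<close>, and it is central because products with an element of \<open>R\<close> lie
  in \<open>I\<close> (\<open>H_central_extension\<close>).

  \<^emph>\<open>Existence of covering maps.\<close> Let \<open>\<phi>\<^sub>1 : H\<^sub>1 \<rightarrow> L\<close> be a central extension. A free algebra is projective,
  so \<open>\<pi> : F \<rightarrow> L\<close> lifts to some \<open>g : F \<rightarrow> H\<^sub>1\<close> (\<open>free_dialgebra_lift\<close>). It sends \<open>R\<close> into the kernel of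
  \<open>\<phi>\<^sub>1\<close>, which is central, hence kills \<open>I\<close> (\<open>lift_vanishes\<close>), and its restriction to \<open>F'\<close> factors
  through \<open>H\<close> (\<open>lift_covering_map\<close>).

  \<^emph>\<open>Uniqueness.\<close> Two covering maps differ at each point by a central element of \<open>H\<^sub>1\<close>, and
  central summands do not affect products. So the two maps agree on all products, hence on
  \<open>H \<lozenge> H\<close> (\<open>covering_maps_unique\<close>). This is all of \<open>H\<close>: since \<open>\<pi>(F') = L\<close> gives
  \<open>F = R + F'\<close>, every product of two elements of \<open>F\<close> is modulo \<open>I\<close> a product of two elements of
  \<open>F'\<close> (\<open>H_perfect\<close>).
\<close>

section \<open>Submodules and bilinear products\<close>

text \<open>Closure under negation follows from closure under multiplication by \<open>-1\<close>. The condition then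
  involves the carrier of \<open>M\<close> only through the inclusion, so it passes easily between an algebra
  and its subalgebras.\<close>

lemma (in module) submodule_iff:
  "submodule N R M \<longleftrightarrow> N \<subseteq> carrier M \<and> \<zero>\<^bsub>M\<^esub> \<in> N \<and>
    (\<forall>x\<in>N. \<forall>y\<in>N. x \<oplus>\<^bsub>M\<^esub> y \<in> N) \<and> (\<forall>c\<in>carrier R. \<forall>x\<in>N. c \<odot>\<^bsub>M\<^esub> x \<in> N)"
proof
  assume N: "submodule N R M"
  then obtain x where x: "x \<in> N" using submoduleE(2) by blast
  have "\<zero>\<^bsub>R\<^esub> \<odot>\<^bsub>M\<^esub> x \<in> N" using submoduleE(4)[OF N _ x] by simp
  then have "\<zero>\<^bsub>M\<^esub> \<in> N" using x submoduleE(1)[OF N] by auto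
  then show "N \<subseteq> carrier M \<and> \<zero>\<^bsub>M\<^esub> \<in> N \<and>
    (\<forall>x\<in>N. \<forall>y\<in>N. x \<oplus>\<^bsub>M\<^esub> y \<in> N) \<and> (\<forall>c\<in>carrier R. \<forall>x\<in>N. c \<odot>\<^bsub>M\<^esub> x \<in> N)"
    using submoduleE[OF N] by auto
next
  assume N: "N \<subseteq> carrier M \<and> \<zero>\<^bsub>M\<^esub> \<in> N \<and>
    (\<forall>x\<in>N. \<forall>y\<in>N. x \<oplus>\<^bsub>M\<^esub> y \<in> N) \<and> (\<forall>c\<in>carrier R. \<forall>x\<in>N. c \<odot>\<^bsub>M\<^esub> x \<in> N)"
  show "submodule N R M"
  proof (rule submoduleI)
    fix a assume a: "a \<in> N"
    have "(\<ominus>\<^bsub>R\<^esub> \<one>\<^bsub>R\<^esub>) \<odot>\<^bsub>M\<^esub> a \<in> N" using N a by simp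
    moreover have "a \<in> carrier M" using N a by auto
    ultimately show "\<ominus>\<^bsub>M\<^esub> a \<in> N" by (simp add: smult_l_minus)
  qed (use N in auto)
qed

lemma (in module) linear_span_submodule:
  assumes "S \<subseteq> carrier M"
  shows "submodule (linear_span R M S) R M"
  using assms carrier_is_submodule unfolding linear_span_def hull_def submodule_iff by blast

lemma linear_span_superset: "S \<subseteq> linear_span K M S"
  unfolding linear_span_def by (rule hull_subset)

lemma linear_span_least: "submodule N K M \<Longrightarrow> S \<subseteq> N \<Longrightarrow> linear_span K M S \<subseteq> N"
  unfolding linear_span_def by (rule hull_minimal)

lemma (in module) submodule_set_add:
  assumes "submodule N R M" "submodule P R M"
  shows "submodule (N <+>\<^bsub>M\<^esub> P) R M"
proof -
  have N: "N \<subseteq> carrier M" "\<zero>\<^bsub>M\<^esub> \<in> N" "\<And>x y. x \<in> N \<Longrightarrow> y \<in> N \<Longrightarrow> x \<oplus>\<^bsub>M\<^esub> y \<in> N"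
      "\<And>c x. c \<in> carrier R \<Longrightarrow> x \<in> N \<Longrightarrow> c \<odot>\<^bsub>M\<^esub> x \<in> N"
    and P: "P \<subseteq> carrier M" "\<zero>\<^bsub>M\<^esub> \<in> P" "\<And>x y. x \<in> P \<Longrightarrow> y \<in> P \<Longrightarrow> x \<oplus>\<^bsub>M\<^esub> y \<in> P"
      "\<And>c x. c \<in> carrier R \<Longrightarrow> x \<in> P \<Longrightarrow> c \<odot>\<^bsub>M\<^esub> x \<in> P"
    using assms unfolding submodule_iff by auto
  have mem: "z \<in> N <+>\<^bsub>M\<^esub> P \<longleftrightarrow> (\<exists>x\<in>N. \<exists>y\<in>P. z = x \<oplus>\<^bsub>M\<^esub> y)" for z
    by (auto simp: set_add_def')
  show ?thesis
    unfolding submodule_iff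
  proof (intro conjI ballI)
    show "N <+>\<^bsub>M\<^esub> P \<subseteq> carrier M" using N(1) P(1) by (auto simp: mem subset_iff)
    show "\<zero>\<^bsub>M\<^esub> \<in> N <+>\<^bsub>M\<^esub> P"
      unfolding mem using N(2) P(2) by (metis M.zero_closed M.l_zero)
  next
    fix z w assume "z \<in> N <+>\<^bsub>M\<^esub> P" "w \<in> N <+>\<^bsub>M\<^esub> P"
    then obtain x y x' y' where *: "x \<in> N" "y \<in> P" "z = x \<oplus>\<^bsub>M\<^esub> y" "x' \<in> N" "y' \<in> P" "w = x' \<oplus>\<^bsub>M\<^esub> y'"
      unfolding mem by blast
    moreover have "x \<in> carrier M" "y \<in> carrier M" "x' \<in> carrier M" "y' \<in> carrier M"
      using * N(1) P(1) by auto
    ultimately have "z \<oplus>\<^bsub>M\<^esub> w = (x \<oplus>\<^bsub>M\<^esub> x') \<oplus>\<^bsub>M\<^esub> (y \<oplus>\<^bsub>M\<^esub> y')"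
      by (simp add: M.a_ac)
    then show "z \<oplus>\<^bsub>M\<^esub> w \<in> N <+>\<^bsub>M\<^esub> P" unfolding mem using * N(3) P(3) by blast
  next
    fix c z assume c: "c \<in> carrier R" and "z \<in> N <+>\<^bsub>M\<^esub> P"
    then obtain x y where *: "x \<in> N" "y \<in> P" "z = x \<oplus>\<^bsub>M\<^esub> y" unfolding mem by blast
    then have "c \<odot>\<^bsub>M\<^esub> z = c \<odot>\<^bsub>M\<^esub> x \<oplus>\<^bsub>M\<^esub> c \<odot>\<^bsub>M\<^esub> y"
      using c N(1) P(1) by (auto intro!: smult_r_distr)
    then show "c \<odot>\<^bsub>M\<^esub> z \<in> N <+>\<^bsub>M\<^esub> P" unfolding mem using * c N(4) P(4) by blast
  qed
qed

lemma (in module) set_add_superset: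
  assumes "submodule N R M" "submodule P R M"
  shows "N \<subseteq> N <+>\<^bsub>M\<^esub> P" and "P \<subseteq> N <+>\<^bsub>M\<^esub> P"
proof -
  have N: "N \<subseteq> carrier M" "\<zero>\<^bsub>M\<^esub> \<in> N" and P: "P \<subseteq> carrier M" "\<zero>\<^bsub>M\<^esub> \<in> P"
    using assms unfolding submodule_iff by auto
  show "N \<subseteq> N <+>\<^bsub>M\<^esub> P"
  proof
    fix x assume x: "x \<in> N"
    then have "x = x \<oplus>\<^bsub>M\<^esub> \<zero>\<^bsub>M\<^esub>" using N by auto
    then show "x \<in> N <+>\<^bsub>M\<^esub> P" unfolding set_add_def' using x P by blast
  qed
  show "P \<subseteq> N <+>\<^bsub>M\<^esub> P"
  proof
    fix x assume x: "x \<in> P"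
    then have "x = \<zero>\<^bsub>M\<^esub> \<oplus>\<^bsub>M\<^esub> x" using P by auto
    then show "x \<in> N <+>\<^bsub>M\<^esub> P" unfolding set_add_def' using x N by blast
  qed
qed

lemma (in module) set_add_least:
  assumes "submodule Q R M" "N \<subseteq> Q" "P \<subseteq> Q"
  shows "N <+>\<^bsub>M\<^esub> P \<subseteq> Q"
  using assms unfolding submodule_iff set_add_def' by (auto simp: subset_iff)

lemma bilinear_productD:
  assumes "bilinear_product K M p"
  shows "x \<in> carrier M \<Longrightarrow> y \<in> carrier M \<Longrightarrow> p x y \<in> carrier M"
    and "x \<in> carrier M \<Longrightarrow> y \<in> carrier M \<Longrightarrow> z \<in> carrier M \<Longrightarrow>
      p (x \<oplus>\<^bsub>M\<^esub> y) z = p x z \<oplus>\<^bsub>M\<^esub> p y z"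
    and "x \<in> carrier M \<Longrightarrow> y \<in> carrier M \<Longrightarrow> z \<in> carrier M \<Longrightarrow>
      p x (y \<oplus>\<^bsub>M\<^esub> z) = p x y \<oplus>\<^bsub>M\<^esub> p x z"
    and "c \<in> carrier K \<Longrightarrow> x \<in> carrier M \<Longrightarrow> y \<in> carrier M \<Longrightarrow>
      p (c \<odot>\<^bsub>M\<^esub> x) y = c \<odot>\<^bsub>M\<^esub> p x y"
    and "c \<in> carrier K \<Longrightarrow> x \<in> carrier M \<Longrightarrow> y \<in> carrier M \<Longrightarrow>
      p x (c \<odot>\<^bsub>M\<^esub> y) = c \<odot>\<^bsub>M\<^esub> p x y"
  using assms unfolding bilinear_product_def by auto

lemma (in module) bilinear_zero:
  assumes "bilinear_product R M p" "x \<in> carrier M"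
  shows "p \<zero>\<^bsub>M\<^esub> x = \<zero>\<^bsub>M\<^esub>" and "p x \<zero>\<^bsub>M\<^esub> = \<zero>\<^bsub>M\<^esub>"
proof -
  note p = bilinear_productD[OF assms(1)]
  show "p \<zero>\<^bsub>M\<^esub> x = \<zero>\<^bsub>M\<^esub>"
    using p(4)[of "\<zero>\<^bsub>R\<^esub>" "\<zero>\<^bsub>M\<^esub>" x] p(1)[of "\<zero>\<^bsub>M\<^esub>" x] assms(2) by simp
  show "p x \<zero>\<^bsub>M\<^esub> = \<zero>\<^bsub>M\<^esub>"
    using p(5)[of "\<zero>\<^bsub>R\<^esub>" x "\<zero>\<^bsub>M\<^esub>"] p(1)[of x "\<zero>\<^bsub>M\<^esub>"] assms(2) by simp
qed

text \<open>By this, a closure property under products has to be checked only on elements that span.\<close>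

lemma (in module) multiplier_submodule:
  assumes p: "bilinear_product R M p" and N: "submodule N R M" and x: "x \<in> carrier M"
  shows "submodule {t \<in> carrier M. p x t \<in> N} R M"
    and "submodule {t \<in> carrier M. p t x \<in> N} R M"
  using N x bilinear_zero[OF p x] bilinear_productD(2-)[OF p]
  unfolding submodule_iff by auto


section \<open>Subalgebras and ideals\<close>

lemma diassociative_module: "diassociative_algebra K D \<Longrightarrow> module K D"
  by (rule diassociative_algebra.axioms(2))

lemma (in diassociative_algebra) lozenge_submodule:
  assumes "S \<subseteq> carrier D" "T \<subseteq> carrier D"
  shows "submodule (lozenge K D S T) K D"
  unfolding lozenge_def
  using assms bilinear_productD(1)[OF lprod_bilinear] bilinear_productD(1)[OF rprod_bilinear]
  by (intro linear_span_submodule) blast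

lemma lozengeI:
  assumes "s \<in> S" "t \<in> T"
  shows "s \<stileturn>\<^bsub>D\<^esub> t \<in> lozenge K D S T" and "s \<turnstile>\<^bsub>D\<^esub> t \<in> lozenge K D S T"
  unfolding lozenge_def
  by (rule subsetD[OF linear_span_superset], use assms in blast)+

lemma lozenge_least:
  assumes "submodule N K D"
    and "\<And>s t. s \<in> S \<Longrightarrow> t \<in> T \<Longrightarrow> s \<stileturn>\<^bsub>D\<^esub> t \<in> N \<and> s \<turnstile>\<^bsub>D\<^esub> t \<in> N"
  shows "lozenge K D S T \<subseteq> N"
  unfolding lozenge_def using assms by (intro linear_span_least) auto

definition diideal ::
  "('k, 'm) ring_scheme \<Rightarrow> ('k, 'a, 'n) dialgebra_scheme \<Rightarrow> 'a set \<Rightarrow> bool"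
  where "diideal K D J \<longleftrightarrow> submodule J K D \<and>
    (\<forall>x\<in>carrier D. \<forall>y\<in>J. x \<stileturn>\<^bsub>D\<^esub> y \<in> J \<and> x \<turnstile>\<^bsub>D\<^esub> y \<in> J \<and> y \<stileturn>\<^bsub>D\<^esub> x \<in> J \<and> y \<turnstile>\<^bsub>D\<^esub> x \<in> J)"

lemma (in diassociative_algebra) derived_diideal: "diideal K D (derived_algebra K D)"
proof -
  have sub: "submodule (derived_algebra K D) K D"
    unfolding derived_algebra_def by (rule lozenge_submodule) auto
  then show ?thesis
    unfolding diideal_def using lozengeI[of _ "carrier D" _ "carrier D" D K]
    by (auto simp: submodule_iff derived_algebra_def subset_iff)
qed

lemma (in diassociative_algebra) ideal_diassociative:
  assumes S: "diideal K D S"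
  shows "diassociative_algebra K (D\<lparr>carrier := S\<rparr>)"
proof -
  have sub: "submodule S K D" using S by (simp add: diideal_def)
  then have le: "S \<subseteq> carrier D" by (simp add: submodule_iff)
  have mod: "module K (D\<lparr>carrier := S\<rparr>)"
    by (rule submodule.submodule_is_module[OF sub]) (rule module_axioms)
  have bil: "bilinear_product K (D\<lparr>carrier := S\<rparr>) p"
    if "bilinear_product K D p" "\<And>x y. x \<in> S \<Longrightarrow> y \<in> S \<Longrightarrow> p x y \<in> S" for p
    using that le unfolding bilinear_product_def by (simp add: subset_iff)
  have "diassociative_algebra_axioms K (D\<lparr>carrier := S\<rparr>)"
    unfolding diassociative_algebra_axioms_def
    using le S lprod_assoc rprod_assoc lprod_lprod_rprod rprod_lprod lprod_rprod_rprod
    by (auto intro!: bil lprod_bilinear rprod_bilinear simp: diideal_def subset_iff)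
  then show ?thesis
    by (intro diassociative_algebra.intro mod) (rule field_axioms)
qed

lemma (in diassociative_algebra) submodule_ideal_iff:
  assumes S: "diideal K D S"
  shows "submodule N K (D\<lparr>carrier := S\<rparr>) \<longleftrightarrow> submodule N K D \<and> N \<subseteq> S"
proof -
  have le: "S \<subseteq> carrier D" using S by (simp add: diideal_def submodule_iff)
  interpret S: diassociative_algebra K "D\<lparr>carrier := S\<rparr>"
    by (rule ideal_diassociative[OF S])
  show ?thesis using le unfolding submodule_iff S.submodule_iff by auto
qed

text \<open>For an ideal \<open>R\<close> of \<open>F\<close>, this is the smallest ideal modulo which \<open>R\<close> becomes central.\<close>

definition mutual_ideal ::
  "('k, 'm) ring_scheme \<Rightarrow> ('k, 'a, 'n) dialgebra_scheme \<Rightarrow> 'a set \<Rightarrow> 'a set"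
  where "mutual_ideal K F R = lozenge K F (carrier F) R <+>\<^bsub>F\<^esub> lozenge K F R (carrier F)"

lemma (in diassociative_algebra) mutual_ideal_least:
  assumes "submodule N K D"
    and "\<And>x r. x \<in> carrier D \<Longrightarrow> r \<in> R \<Longrightarrow>
      x \<stileturn> r \<in> N \<and> x \<turnstile> r \<in> N \<and> r \<stileturn> x \<in> N \<and> r \<turnstile> x \<in> N"
  shows "mutual_ideal K D R \<subseteq> N"
  unfolding mutual_ideal_def using assms by (intro set_add_least lozenge_least) auto

lemma (in diassociative_algebra) mutual_idealI:
  assumes "R \<subseteq> carrier D" "x \<in> carrier D" "r \<in> R"
  shows "x \<stileturn> r \<in> mutual_ideal K D R" "x \<turnstile> r \<in> mutual_ideal K D R"
    "r \<stileturn> x \<in> mutual_ideal K D R" "r \<turnstile> x \<in> mutual_ideal K D R"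
proof -
  have sub: "submodule (lozenge K D (carrier D) R) K D" "submodule (lozenge K D R (carrier D)) K D"
    using assms(1) by (auto intro: lozenge_submodule)
  show "x \<stileturn> r \<in> mutual_ideal K D R" "x \<turnstile> r \<in> mutual_ideal K D R"
    "r \<stileturn> x \<in> mutual_ideal K D R" "r \<turnstile> x \<in> mutual_ideal K D R"
    unfolding mutual_ideal_def
    by (rule subsetD[OF set_add_superset(1)[OF sub]] subsetD[OF set_add_superset(2)[OF sub]],
        rule lozengeI; rule assms)+
qed

text \<open>Multiplying a generator \<open>y \<star> r\<close> or \<open>r \<star> y\<close> by \<open>x\<close> and reassociating gives a product of \<open>r\<close> with an
  element of \<open>D\<close>, or of \<open>y\<close> with a product of \<open>x\<close> and \<open>r\<close>, which lies in \<open>R\<close>. In the two patterns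
  \<open>x \<stileturn> (y \<turnstile> r)\<close> and \<open>(r \<stileturn> y) \<turnstile> x\<close>, also with \<open>y\<close> and \<open>r\<close> interchanged, there is
  no law that only moves the brackets, and one of the products has to be exchanged first.\<close>

lemma (in diassociative_algebra) mutual_ideal_diideal:
  assumes R: "diideal K D R"
  shows "diideal K D (mutual_ideal K D R)"
proof -
  define I where "I = mutual_ideal K D R"
  have le: "R \<subseteq> carrier D" using R by (simp add: diideal_def submodule_iff)
  have I: "submodule I K D"
    unfolding I_def mutual_ideal_def using le by (auto intro!: submodule_set_add lozenge_submodule)
  note gen = mutual_idealI[OF le, folded I_def] and least = mutual_ideal_least[where R = R, folded I_def]
  have absorb: "x \<stileturn> r \<in> R" "x \<turnstile> r \<in> R" "r \<stileturn> x \<in> R" "r \<turnstile> x \<in> R" if "x \<in> carrier D" "r \<in> R" for x r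
    using that R by (auto simp: diideal_def)
  note cl = bilinear_productD(1)[OF lprod_bilinear] bilinear_productD(1)[OF rprod_bilinear]
  have "x \<stileturn> y \<in> I \<and> x \<turnstile> y \<in> I \<and> y \<stileturn> x \<in> I \<and> y \<turnstile> x \<in> I" if x: "x \<in> carrier D" and y: "y \<in> I" for x y
  proof -
    have "I \<subseteq> {t \<in> carrier D. x \<stileturn> t \<in> I}"
    proof (rule least[OF multiplier_submodule(1)[OF lprod_bilinear I x]])
      fix y r assume y: "y \<in> carrier D" and r: "r \<in> R"
      then have rc: "r \<in> carrier D" using le by auto
      show "y \<stileturn> r \<in> {t \<in> carrier D. x \<stileturn> t \<in> I} \<and> y \<turnstile> r \<in> {t \<in> carrier D. x \<stileturn> t \<in> I} \<and>
        r \<stileturn> y \<in> {t \<in> carrier D. x \<stileturn> t \<in> I} \<and> r \<turnstile> y \<in> {t \<in> carrier D. x \<stileturn> t \<in> I}"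
        using x y r rc gen absorb cl by (auto simp flip: lprod_lprod_rprod)
    qed
    moreover have "I \<subseteq> {t \<in> carrier D. x \<turnstile> t \<in> I}"
    proof (rule least[OF multiplier_submodule(1)[OF rprod_bilinear I x]])
      fix y r assume y: "y \<in> carrier D" and r: "r \<in> R"
      then have rc: "r \<in> carrier D" using le by auto
      show "y \<stileturn> r \<in> {t \<in> carrier D. x \<turnstile> t \<in> I} \<and> y \<turnstile> r \<in> {t \<in> carrier D. x \<turnstile> t \<in> I} \<and>
        r \<stileturn> y \<in> {t \<in> carrier D. x \<turnstile> t \<in> I} \<and> r \<turnstile> y \<in> {t \<in> carrier D. x \<turnstile> t \<in> I}"
        using x y r rc gen absorb cl by auto
    qed
    moreover have "I \<subseteq> {t \<in> carrier D. t \<stileturn> x \<in> I}"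
    proof (rule least[OF multiplier_submodule(2)[OF lprod_bilinear I x]])
      fix y r assume y: "y \<in> carrier D" and r: "r \<in> R"
      then have rc: "r \<in> carrier D" using le by auto
      show "y \<stileturn> r \<in> {t \<in> carrier D. t \<stileturn> x \<in> I} \<and> y \<turnstile> r \<in> {t \<in> carrier D. t \<stileturn> x \<in> I} \<and>
        r \<stileturn> y \<in> {t \<in> carrier D. t \<stileturn> x \<in> I} \<and> r \<turnstile> y \<in> {t \<in> carrier D. t \<stileturn> x \<in> I}"
        using x y r rc gen absorb cl by auto
    qed
    moreover have "I \<subseteq> {t \<in> carrier D. t \<turnstile> x \<in> I}"
    proof (rule least[OF multiplier_submodule(2)[OF rprod_bilinear I x]])
      fix y r assume y: "y \<in> carrier D" and r: "r \<in> R"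
      then have rc: "r \<in> carrier D" using le by auto
      show "y \<stileturn> r \<in> {t \<in> carrier D. t \<turnstile> x \<in> I} \<and> y \<turnstile> r \<in> {t \<in> carrier D. t \<turnstile> x \<in> I} \<and>
        r \<stileturn> y \<in> {t \<in> carrier D. t \<turnstile> x \<in> I} \<and> r \<turnstile> y \<in> {t \<in> carrier D. t \<turnstile> x \<in> I}"
        using x y r rc gen absorb cl by (auto simp: lprod_rprod_rprod)
    qed
    ultimately show ?thesis using y by blast
  qed
  then show ?thesis using I unfolding diideal_def I_def[symmetric] by blast
qed


section \<open>Homomorphisms\<close>

lemma dihomD:
  assumes "f \<in> dihom K D E"
  shows "x \<in> carrier D \<Longrightarrow> f x \<in> carrier E"
    and "x \<in> carrier D \<Longrightarrow> y \<in> carrier D \<Longrightarrow> f (x \<oplus>\<^bsub>D\<^esub> y) = f x \<oplus>\<^bsub>E\<^esub> f y"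
    and "x \<in> carrier D \<Longrightarrow> y \<in> carrier D \<Longrightarrow> f (x \<stileturn>\<^bsub>D\<^esub> y) = f x \<stileturn>\<^bsub>E\<^esub> f y"
    and "x \<in> carrier D \<Longrightarrow> y \<in> carrier D \<Longrightarrow> f (x \<turnstile>\<^bsub>D\<^esub> y) = f x \<turnstile>\<^bsub>E\<^esub> f y"
    and "c \<in> carrier K \<Longrightarrow> x \<in> carrier D \<Longrightarrow> f (c \<odot>\<^bsub>D\<^esub> x) = c \<odot>\<^bsub>E\<^esub> f x"
  using assms unfolding dihom_def by auto

lemma dihom_comp:
  assumes "f \<in> dihom K D E" "g \<in> dihom K E G"
  shows "(\<lambda>x. g (f x)) \<in> dihom K D G"
  using dihomD[OF assms(1)] dihomD[OF assms(2)] unfolding dihom_def by auto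

lemma (in diassociative_algebra) dihom_restrict:
  assumes "f \<in> dihom K D E"
  shows "restrict f (carrier D) \<in> dihom K D E"
  using dihomD[OF assms] bilinear_productD(1)[OF lprod_bilinear] bilinear_productD(1)[OF rprod_bilinear]
  unfolding dihom_def by auto

lemma dihom_subalgebra:
  assumes "f \<in> dihom K D E" "S \<subseteq> carrier D"
  shows "f \<in> dihom K (D\<lparr>carrier := S\<rparr>) E"
  using assms unfolding dihom_def by (auto simp: subset_iff)

lemma dihom_zero:
  assumes "f \<in> dihom K D E" "module K D" "module K E"
  shows "f \<zero>\<^bsub>D\<^esub> = \<zero>\<^bsub>E\<^esub>"
proof -
  interpret D: module K D by fact
  interpret E: module K E by fact
  show ?thesis
    using dihomD(5)[OF assms(1), of "\<zero>\<^bsub>K\<^esub>" "\<zero>\<^bsub>D\<^esub>"] dihomD(1)[OF assms(1), of "\<zero>\<^bsub>D\<^esub>"] by simp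
qed

lemma dihom_vimage_submodule:
  assumes f: "f \<in> dihom K D E" and D: "module K D" and E: "module K E" and N: "submodule N K E"
  shows "submodule {x \<in> carrier D. f x \<in> N} K D"
proof -
  interpret D: module K D by fact
  interpret E: module K E by fact
  show ?thesis
    using N dihomD[OF f] dihom_zero[OF f D E] unfolding D.submodule_iff E.submodule_iff by auto
qed

lemma dihom_equalizer_submodule:
  assumes f: "f \<in> dihom K D E" and g: "g \<in> dihom K D E" and D: "module K D" and E: "module K E"
  shows "submodule {x \<in> carrier D. f x = g x} K D"
proof -
  interpret D: module K D by fact
  interpret E: module K E by fact
  show ?thesis
    using dihomD[OF f] dihomD[OF g] dihom_zero[OF f D E] dihom_zero[OF g D E]
    unfolding D.submodule_iff by auto
qed

lemma kernel_diideal: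
  assumes f: "f \<in> dihom K D E" and D: "diassociative_algebra K D" and E: "diassociative_algebra K E"
  shows "diideal K D (a_kernel D E f)"
proof -
  interpret D: diassociative_algebra K D by fact
  interpret E: diassociative_algebra K E by fact
  have "submodule {\<zero>\<^bsub>E\<^esub>} K E" by (auto simp: E.submodule_iff)
  from dihom_vimage_submodule[OF f D.module_axioms E.module_axioms this]
  have "submodule (a_kernel D E f) K D" by (simp add: a_kernel_def')
  then show ?thesis
    using dihomD[OF f] bilinear_productD(1)[OF D.lprod_bilinear] bilinear_productD(1)[OF D.rprod_bilinear]
      E.bilinear_zero[OF E.lprod_bilinear] E.bilinear_zero[OF E.rprod_bilinear]
    by (auto simp: diideal_def a_kernel_def')
qed

text \<open>The laws are equations between values of operations, so they pass to surjective images. This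
  gives them in quotients and in copies of an algebra on another type.\<close>

lemma dihom_image_diassociative:
  assumes D: "diassociative_algebra K D" and f: "f \<in> dihom K D E"
    and onto: "f ` carrier D = carrier E" and zero: "f \<zero>\<^bsub>D\<^esub> = \<zero>\<^bsub>E\<^esub>"
  shows "diassociative_algebra K E"
proof -
  interpret D: diassociative_algebra K D by fact
  note cl = bilinear_productD(1)[OF D.lprod_bilinear] bilinear_productD(1)[OF D.rprod_bilinear]
  have ex: "\<exists>u\<in>carrier D. x = f u" if "x \<in> carrier E" for x using that onto by auto
  note hom = dihomD(2-5)[OF f, symmetric]
  have ball: "(\<forall>x\<in>carrier E. P x) \<longleftrightarrow> (\<forall>u\<in>carrier D. P (f u))" for P
    unfolding onto[symmetric] by blast
  have "abelian_group E"
  proof (rule abelian_groupI)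
    show "\<zero>\<^bsub>E\<^esub> \<in> carrier E" unfolding zero[symmetric] using dihomD(1)[OF f] by simp
  next
    fix x y assume "x \<in> carrier E" "y \<in> carrier E"
    then obtain u v where "u \<in> carrier D" "v \<in> carrier D" "x = f u" "y = f v" using ex by meson
    then show "x \<oplus>\<^bsub>E\<^esub> y \<in> carrier E" "x \<oplus>\<^bsub>E\<^esub> y = y \<oplus>\<^bsub>E\<^esub> x"
      using dihomD(1)[OF f] by (auto simp: hom D.M.a_comm)
  next
    fix x y z assume "x \<in> carrier E" "y \<in> carrier E" "z \<in> carrier E"
    then obtain u v w where "u \<in> carrier D" "v \<in> carrier D" "w \<in> carrier D"
      "x = f u" "y = f v" "z = f w" using ex by meson
    then show "(x \<oplus>\<^bsub>E\<^esub> y) \<oplus>\<^bsub>E\<^esub> z = x \<oplus>\<^bsub>E\<^esub> (y \<oplus>\<^bsub>E\<^esub> z)" by (simp add: hom D.M.a_assoc)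
  next
    fix x assume "x \<in> carrier E"
    then obtain u where u: "u \<in> carrier D" "x = f u" using ex by meson
    then show "\<zero>\<^bsub>E\<^esub> \<oplus>\<^bsub>E\<^esub> x = x" by (simp add: hom flip: zero)
    show "\<exists>y\<in>carrier E. y \<oplus>\<^bsub>E\<^esub> x = \<zero>\<^bsub>E\<^esub>"
      using u dihomD(1)[OF f] by (intro bexI[of _ "f (\<ominus>\<^bsub>D\<^esub> u)"]) (simp_all add: hom D.M.l_neg flip: zero)
  qed
  moreover have "module_axioms K E"
    unfolding module_axioms_def onto[symmetric]
    by (auto simp: hom D.smult_l_distr D.smult_r_distr D.smult_assoc1)
  ultimately have mod: "module K E"
    by (intro module.intro) (rule D.is_cring)
  have "diassociative_algebra_axioms K E"
    unfolding diassociative_algebra_axioms_def bilinear_product_def onto[symmetric]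
    using cl
    by (auto simp: hom D.lprod_assoc D.rprod_assoc D.rprod_lprod D.lprod_rprod_rprod
        bilinear_productD(2-)[OF D.lprod_bilinear] bilinear_productD(2-)[OF D.rprod_bilinear]
        simp flip: D.lprod_lprod_rprod)
  then show ?thesis
    by (intro diassociative_algebra.intro mod) (rule D.field_axioms)
qed


section \<open>Quotients\<close>

lemma a_r_coset_carrier_update: "J +>\<^bsub>D\<lparr>carrier := S\<rparr>\<^esub> x = J +>\<^bsub>D\<^esub> x"
  by (simp add: a_r_coset_def')

lemma (in module) coset_eqI:
  assumes J: "submodule J R M" and x: "x \<in> carrier M" and y: "y \<in> J +>\<^bsub>M\<^esub> x"
  shows "J +>\<^bsub>M\<^esub> y = J +>\<^bsub>M\<^esub> x"
  using M.a_repr_independence[OF y x submodule.axioms(1)[OF J]] by simp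

text \<open>The union in the definition of the quotient operations is a single coset, because all products of
  representatives are congruent.\<close>

lemma (in module) coset_product:
  assumes p: "bilinear_product R M p" and J: "submodule J R M"
    and absorb: "\<And>x y. x \<in> carrier M \<Longrightarrow> y \<in> J \<Longrightarrow> p x y \<in> J \<and> p y x \<in> J"
    and x: "x \<in> carrier M" and y: "y \<in> carrier M"
  shows "(\<Union>u\<in>J +>\<^bsub>M\<^esub> x. \<Union>v\<in>J +>\<^bsub>M\<^esub> y. J +>\<^bsub>M\<^esub> p u v) = J +>\<^bsub>M\<^esub> p x y"
proof -
  note p' = bilinear_productD[OF p]
  have J': "J \<subseteq> carrier M" "\<zero>\<^bsub>M\<^esub> \<in> J" "\<And>x y. x \<in> J \<Longrightarrow> y \<in> J \<Longrightarrow> x \<oplus>\<^bsub>M\<^esub> y \<in> J"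
    using J by (auto simp: submodule_iff)
  have "J +>\<^bsub>M\<^esub> p u v = J +>\<^bsub>M\<^esub> p x y" if u: "u \<in> J +>\<^bsub>M\<^esub> x" and v: "v \<in> J +>\<^bsub>M\<^esub> y" for u v
  proof (rule coset_eqI[OF J p'(1)[OF x y]])
    obtain i j where ij: "i \<in> J" "j \<in> J" "u = i \<oplus>\<^bsub>M\<^esub> x" "v = j \<oplus>\<^bsub>M\<^esub> y"
      using u v by (auto simp: a_r_coset_def')
    then have c: "i \<in> carrier M" "j \<in> carrier M" using J' by auto
    have "p u v = (p i j \<oplus>\<^bsub>M\<^esub> p i y \<oplus>\<^bsub>M\<^esub> p x j) \<oplus>\<^bsub>M\<^esub> p x y"
      using c x y by (simp add: ij p' M.a_ac)
    moreover have "p i j \<oplus>\<^bsub>M\<^esub> p i y \<oplus>\<^bsub>M\<^esub> p x j \<in> J"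
      using absorb[OF x ij(2)] absorb[OF y ij(1)] absorb[OF c(1) ij(2)] J'(3) by blast
    ultimately show "p u v \<in> J +>\<^bsub>M\<^esub> p x y" by (auto simp: a_r_coset_def')
  qed
  moreover have "x \<in> J +>\<^bsub>M\<^esub> x" if "x \<in> carrier M" for x
    using that J'(2) unfolding a_r_coset_def' by (auto intro!: bexI[of _ "\<zero>\<^bsub>M\<^esub>"])
  ultimately show ?thesis using x y by blast
qed

lemma (in module) coset_smult:
  assumes J: "submodule J R M" and c: "c \<in> carrier R" and x: "x \<in> carrier M"
  shows "(\<Union>u\<in>J +>\<^bsub>M\<^esub> x. J +>\<^bsub>M\<^esub> (c \<odot>\<^bsub>M\<^esub> u)) = J +>\<^bsub>M\<^esub> (c \<odot>\<^bsub>M\<^esub> x)"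
proof -
  have J': "J \<subseteq> carrier M" "\<zero>\<^bsub>M\<^esub> \<in> J" "\<And>x. x \<in> J \<Longrightarrow> c \<odot>\<^bsub>M\<^esub> x \<in> J"
    using J c by (auto simp: submodule_iff)
  have "J +>\<^bsub>M\<^esub> (c \<odot>\<^bsub>M\<^esub> u) = J +>\<^bsub>M\<^esub> (c \<odot>\<^bsub>M\<^esub> x)" if u: "u \<in> J +>\<^bsub>M\<^esub> x" for u
  proof (rule coset_eqI[OF J smult_closed[OF c x]])
    obtain i where i: "i \<in> J" "u = i \<oplus>\<^bsub>M\<^esub> x" using u by (auto simp: a_r_coset_def')
    then have "c \<odot>\<^bsub>M\<^esub> u = c \<odot>\<^bsub>M\<^esub> i \<oplus>\<^bsub>M\<^esub> c \<odot>\<^bsub>M\<^esub> x" using c x J'(1) by (auto intro!: smult_r_distr)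
    then show "c \<odot>\<^bsub>M\<^esub> u \<in> J +>\<^bsub>M\<^esub> (c \<odot>\<^bsub>M\<^esub> x)" using J'(3)[OF i(1)] by (auto simp: a_r_coset_def')
  qed
  moreover have "x \<in> J +>\<^bsub>M\<^esub> x"
    using x J'(2) unfolding a_r_coset_def' by (auto intro!: bexI[of _ "\<zero>\<^bsub>M\<^esub>"])
  ultimately show ?thesis by blast
qed

lemma quotient_carrier: "carrier (D DQuot J) = (\<lambda>x. J +>\<^bsub>D\<^esub> x) ` carrier D"
  by (auto simp: quotient_dialgebra_def A_RCOSETS_def')

lemma quotient_zero: "\<zero>\<^bsub>D DQuot J\<^esub> = J"
  by (simp add: quotient_dialgebra_def)

lemma (in diassociative_algebra) coset_map_dihom:
  assumes J: "diideal K D J"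
  shows "(\<lambda>x. J +> x) \<in> dihom K D (D DQuot J)"
proof -
  have sub: "submodule J K D" using J by (simp add: diideal_def)
  interpret J: abelian_subgroup J D
    by (intro abelian_subgroupI3 additive_subgroup.intro submodule.axioms(1)[OF sub] abelian_group_axioms)
  have "(\<Union>u\<in>J +> x. \<Union>v\<in>J +> y. J +> (u \<stileturn> v)) = J +> (x \<stileturn> y)"
    "(\<Union>u\<in>J +> x. \<Union>v\<in>J +> y. J +> (u \<turnstile> v)) = J +> (x \<turnstile> y)"
    if "x \<in> carrier D" "y \<in> carrier D" for x y
    using J that coset_product[OF lprod_bilinear sub] coset_product[OF rprod_bilinear sub]
    by (simp_all add: diideal_def)
  then show ?thesis
    using coset_smult[OF sub]
    by (auto simp: dihom_def quotient_carrier) (simp_all add: quotient_dialgebra_def J.a_rcos_sum)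
qed

lemma (in diassociative_algebra) coset_eq_ideal:
  assumes "diideal K D J" "x \<in> J"
  shows "J +> x = J"
  using assms a_coset_join2[of x J] submodule.axioms(1)[of J K D]
  by (auto simp: diideal_def submodule_iff)

lemma (in diassociative_algebra) quotient_diassociative:
  assumes J: "diideal K D J"
  shows "diassociative_algebra K (D DQuot J)"
proof (rule dihom_image_diassociative[OF _ coset_map_dihom[OF J]])
  have "\<zero> \<in> J" using J by (simp add: diideal_def submodule_iff)
  then show "J +> \<zero> = \<zero>\<^bsub>D DQuot J\<^esub>" by (simp add: quotient_zero coset_eq_ideal[OF J])
qed (simp_all add: quotient_carrier diassociative_algebra_axioms)

text \<open>The universal property of the quotient: \<open>f\<close> is constant on cosets of \<open>J\<close>, so its image of a
  coset is a singleton.\<close>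

lemma (in diassociative_algebra) dihom_factor:
  assumes J: "diideal K D J" and E: "diassociative_algebra K E"
    and f: "f \<in> dihom K D E" and van: "\<And>j. j \<in> J \<Longrightarrow> f j = \<zero>\<^bsub>E\<^esub>"
  shows "x \<in> carrier D \<Longrightarrow> the_elem (f ` (J +> x)) = f x"
    and "(\<lambda>U. the_elem (f ` U)) \<in> dihom K (D DQuot J) E"
proof -
  interpret E: diassociative_algebra K E by fact
  have Jc: "J \<subseteq> carrier D" "\<zero> \<in> J" using J by (auto simp: diideal_def submodule_iff)
  have val: "the_elem (f ` (J +> x)) = f x" if x: "x \<in> carrier D" for x
  proof -
    have "f (j \<oplus> x) = f x" if "j \<in> J" for j
      using that x Jc(1) by (simp add: subset_iff dihomD(1,2)[OF f] van)
    moreover have "f ` (J +> x) = (\<lambda>j. f (j \<oplus> x)) ` J" by (auto simp: a_r_coset_def')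
    ultimately have "f ` (J +> x) = {f x}" using Jc(2) by auto
    then show ?thesis by simp
  qed
  then show "x \<in> carrier D \<Longrightarrow> the_elem (f ` (J +> x)) = f x" .
  note cl = bilinear_productD(1)[OF lprod_bilinear] bilinear_productD(1)[OF rprod_bilinear]
  define q where "q x = J +> x" for x
  have q: "q \<in> dihom K D (D DQuot J)" unfolding q_def by (rule coset_map_dihom[OF J])
  have onto: "carrier (D DQuot J) = q ` carrier D" by (simp add: quotient_carrier q_def)
  have val': "the_elem (f ` q x) = f x" if "x \<in> carrier D" for x using val[OF that] by (simp add: q_def)
  show "(\<lambda>U. the_elem (f ` U)) \<in> dihom K (D DQuot J) E"
    unfolding dihom_def onto
    using cl by (auto simp: dihomD(2-)[OF q, symmetric] val' dihomD[OF f])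
qed


section \<open>Perfect algebras and central extensions\<close>

lemma dihom_image_submodule:
  assumes f: "f \<in> dihom K D E" and D: "module K D" and E: "module K E" and N: "submodule N K D"
  shows "submodule (f ` N) K E"
proof -
  interpret D: module K D by fact
  interpret E: module K E by fact
  have N': "N \<subseteq> carrier D" "\<zero>\<^bsub>D\<^esub> \<in> N" "\<And>x y. x \<in> N \<Longrightarrow> y \<in> N \<Longrightarrow> x \<oplus>\<^bsub>D\<^esub> y \<in> N"
    "\<And>c x. c \<in> carrier K \<Longrightarrow> x \<in> N \<Longrightarrow> c \<odot>\<^bsub>D\<^esub> x \<in> N"
    using N by (auto simp: D.submodule_iff)
  have "f x \<oplus>\<^bsub>E\<^esub> f y \<in> f ` N" if "x \<in> N" "y \<in> N" for x y
    using that N'(1,3) dihomD(2)[OF f, symmetric] by (auto simp: subset_iff)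
  moreover have "c \<odot>\<^bsub>E\<^esub> f x \<in> f ` N" if "c \<in> carrier K" "x \<in> N" for c x
    using that N'(1,4) dihomD(5)[OF f, symmetric] by (auto simp: subset_iff)
  moreover have "\<zero>\<^bsub>E\<^esub> \<in> f ` N" using dihom_zero[OF f D E] N'(2) by force
  ultimately show ?thesis
    using dihomD(1)[OF f] N'(1) by (auto simp: E.submodule_iff)
qed

text \<open>The image of the derived algebra contains all products of elements of \<open>E\<close>.\<close>

lemma derived_onto_perfect:
  assumes f: "f \<in> dihom K D E" and D: "diassociative_algebra K D" and E: "module K E"
    and onto: "f ` carrier D = carrier E" and perf: "perfect K E"
  shows "f ` derived_algebra K D = carrier E"
proof
  interpret D: diassociative_algebra K D by fact
  have sub: "submodule (derived_algebra K D) K D"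
    using D.derived_diideal by (simp add: diideal_def)
  then have le: "derived_algebra K D \<subseteq> carrier D" by (simp add: D.submodule_iff)
  then show "f ` derived_algebra K D \<subseteq> carrier E" using onto by blast
  have "derived_algebra K E \<subseteq> f ` derived_algebra K D"
    unfolding derived_algebra_def[of K E]
  proof (rule lozenge_least)
    show "submodule (f ` derived_algebra K D) K E"
      by (rule dihom_image_submodule[OF f D.module_axioms E sub])
    fix s t assume "s \<in> carrier E" "t \<in> carrier E"
    then obtain u v where uv: "u \<in> carrier D" "v \<in> carrier D" "s = f u" "t = f v"
      using onto by (metis imageE)
    then have "s \<stileturn>\<^bsub>E\<^esub> t = f (u \<stileturn>\<^bsub>D\<^esub> v)" "s \<turnstile>\<^bsub>E\<^esub> t = f (u \<turnstile>\<^bsub>D\<^esub> v)"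
      using dihomD(3,4)[OF f] by auto
    then show "s \<stileturn>\<^bsub>E\<^esub> t \<in> f ` derived_algebra K D \<and> s \<turnstile>\<^bsub>E\<^esub> t \<in> f ` derived_algebra K D"
      using uv unfolding derived_algebra_def by (auto intro: lozengeI)
  qed
  then show "carrier E \<subseteq> f ` derived_algebra K D" using perf by (simp add: perfect_def)
qed

lemma (in diassociative_algebra) product_add_center:
  assumes "u \<in> carrier D" "v \<in> carrier D" "z \<in> center D" "w \<in> center D"
  shows "(z \<oplus> u) \<stileturn> (w \<oplus> v) = u \<stileturn> v" and "(z \<oplus> u) \<turnstile> (w \<oplus> v) = u \<turnstile> v"
proof -
  have "p (z \<oplus> u) (w \<oplus> v) = p u v"
    if p: "bilinear_product K D p" and c: "\<And>z x. z \<in> center D \<Longrightarrow> x \<in> carrier D \<Longrightarrow> p z x = \<zero> \<and> p x z = \<zero>" for p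
  proof -
    have "z \<in> carrier D" "w \<in> carrier D" using assms by (auto simp: center_def)
    then show ?thesis using assms by (simp add: bilinear_productD[OF p] c)
  qed
  from this[OF lprod_bilinear] this[OF rprod_bilinear]
  show "(z \<oplus> u) \<stileturn> (w \<oplus> v) = u \<stileturn> v" "(z \<oplus> u) \<turnstile> (w \<oplus> v) = u \<turnstile> v"
    by (auto simp: center_def)
qed

lemma same_image_differ_by_kernel:
  assumes f: "f \<in> dihom K D E" and D: "module K D" and E: "module K E"
    and xy: "x \<in> carrier D" "y \<in> carrier D" "f x = f y"
  obtains z where "z \<in> a_kernel D E f" "x = z \<oplus>\<^bsub>D\<^esub> y"
proof -
  interpret D: module K D by fact
  interpret E: module K E by fact
  define z where "z = x \<ominus>\<^bsub>D\<^esub> y"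
  have z: "z \<in> carrier D" and x: "x = z \<oplus>\<^bsub>D\<^esub> y"
    using xy unfolding z_def by (simp_all add: a_minus_def D.M.a_assoc D.M.l_neg)
  have "f z \<oplus>\<^bsub>E\<^esub> f y = f y" using dihomD(2)[OF f z xy(2)] xy(3) x by simp
  then have "f z = \<zero>\<^bsub>E\<^esub>" using dihomD(1)[OF f] z xy(2) by (metis E.M.add.r_cancel_one)
  then show ?thesis using that z x by (simp add: a_kernel_def')
qed

text \<open>By centrality of the target, the equalizer of the two maps contains every product in \<open>H\<close>.\<close>

lemma covering_maps_unique:
  assumes H: "diassociative_algebra K H" and perf: "perfect K H"
    and E1: "central_extension K A1 H1 \<phi>1 L"
    and t: "\<tau> \<in> covering_maps K A H \<phi> A1 H1 \<phi>1" and t': "\<tau>' \<in> covering_maps K A H \<phi> A1 H1 \<phi>1"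
  shows "\<tau> = \<tau>'"
proof -
  have H1: "diassociative_algebra K H1" and L: "diassociative_algebra K L"
    and p: "\<phi>1 \<in> dihom K H1 L" and A1: "a_kernel H1 L \<phi>1 \<subseteq> center H1"
    using E1 by (auto simp: central_extension_def extension_def)
  interpret H1: diassociative_algebra K H1 by fact
  note mods = diassociative_module[OF H] diassociative_module[OF H1] diassociative_module[OF L]
  have d: "\<tau> \<in> dihom K H H1" "\<tau>' \<in> dihom K H H1" using t t' by (auto simp: covering_maps_def)
  interpret H: diassociative_algebra K H by fact
  have diff: "\<exists>z\<in>center H1. \<tau> h = z \<oplus>\<^bsub>H1\<^esub> \<tau>' h" if h: "h \<in> carrier H" for h
  proof -
    have "\<phi>1 (\<tau> h) = \<phi>1 (\<tau>' h)" using t t' h by (simp add: covering_maps_def)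
    with same_image_differ_by_kernel[OF p mods(2,3) dihomD(1)[OF d(1) h] dihomD(1)[OF d(2) h]] A1
    show ?thesis by blast
  qed
  have "derived_algebra K H \<subseteq> {h \<in> carrier H. \<tau> h = \<tau>' h}"
    unfolding derived_algebra_def
  proof (rule lozenge_least[OF dihom_equalizer_submodule[OF d mods(1,2)]])
    fix h k assume h: "h \<in> carrier H" and k: "k \<in> carrier H"
    obtain z w where "z \<in> center H1" "\<tau> h = z \<oplus>\<^bsub>H1\<^esub> \<tau>' h" "w \<in> center H1" "\<tau> k = w \<oplus>\<^bsub>H1\<^esub> \<tau>' k"
      using diff h k by blast
    then show "h \<stileturn>\<^bsub>H\<^esub> k \<in> {h \<in> carrier H. \<tau> h = \<tau>' h} \<and> h \<turnstile>\<^bsub>H\<^esub> k \<in> {h \<in> carrier H. \<tau> h = \<tau>' h}"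
      using h k dihomD(1)[OF d(2)] bilinear_productD(1)[OF H.lprod_bilinear] bilinear_productD(1)[OF H.rprod_bilinear]
      by (simp add: dihomD(3,4)[OF d(1)] dihomD(3,4)[OF d(2)] H1.product_add_center)
  qed
  then have "\<tau> h = \<tau>' h" if "h \<in> carrier H" for h using that perf by (auto simp: perfect_def)
  then show ?thesis using t t' by (auto simp: covering_maps_def intro: extensionalityI)
qed


section \<open>Lifting along surjections\<close>

text \<open>The copy of \<open>D\<close> on the image of an injection \<open>s\<close> with left inverse \<open>r\<close>.\<close>

definition transported_dialgebra ::
  "('b \<Rightarrow> 'a) \<Rightarrow> ('a \<Rightarrow> 'b) \<Rightarrow> ('k, 'b, 'n) dialgebra_scheme \<Rightarrow> ('k, 'a) dialgebra"
  where "transported_dialgebra s r D =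
    \<lparr>carrier = s ` carrier D,
     monoid.mult = undefined,
     monoid.one = undefined,
     ring.zero = s \<zero>\<^bsub>D\<^esub>,
     add = (\<lambda>x y. s (r x \<oplus>\<^bsub>D\<^esub> r y)),
     smult = (\<lambda>c x. s (c \<odot>\<^bsub>D\<^esub> r x)),
     lprod = (\<lambda>x y. s (r x \<stileturn>\<^bsub>D\<^esub> r y)),
     rprod = (\<lambda>x y. s (r x \<turnstile>\<^bsub>D\<^esub> r y))\<rparr>"

lemma transported_dialgebra:
  assumes D: "diassociative_algebra K D" and rs: "\<And>x. x \<in> carrier D \<Longrightarrow> r (s x) = x"
  shows "s \<in> dihom K D (transported_dialgebra s r D)"
    and "diassociative_algebra K (transported_dialgebra s r D)"
proof -
  show s: "s \<in> dihom K D (transported_dialgebra s r D)"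
    by (auto simp: dihom_def transported_dialgebra_def rs)
  show "diassociative_algebra K (transported_dialgebra s r D)"
    by (rule dihom_image_diassociative[OF D s]) (simp_all add: transported_dialgebra_def)
qed

text \<open>A free algebra is projective: generators are lifted along a section \<open>s\<close> of \<open>\<phi>\<close>.

  The maps \<open>\<phi> \<circ> g\<close> and \<open>\<pi>\<close> agree on the generators, but take values in an algebra on type \<open>'l\<close>, while
  the uniqueness part of freeness concerns algebras on type \<open>'h\<close>. Therefore \<open>L\<close> is replaced by its
  copy \<open>s(L)\<close> inside the type of \<open>H\<close>.\<close>

lemma free_dialgebra_lift:
  fixes F :: "('k, 'f, 'n) dialgebra_scheme" and H :: "('k, 'h) dialgebra" and L :: "('k, 'l, 'p) dialgebra_scheme"
  assumes F: "free_dialgebra TYPE('h) K F"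
    and H: "diassociative_algebra K H" and L: "diassociative_algebra K L"
    and \<phi>: "\<phi> \<in> dihom K H L" and onto: "\<phi> ` carrier H = carrier L"
    and \<pi>: "\<pi> \<in> dihom K F L"
  obtains g where "g \<in> dihom K F H" "\<And>x. x \<in> carrier F \<Longrightarrow> \<phi> (g x) = \<pi> x"
proof -
  obtain X where X: "X \<subseteq> carrier F"
    and univ0: "\<forall>(D :: ('k, 'h) dialgebra) f. diassociative_algebra K D \<and> f \<in> X \<rightarrow> carrier D \<longrightarrow>
       (\<exists>!g. g \<in> dihom K F D \<inter> extensional (carrier F) \<and> (\<forall>x\<in>X. g x = f x))"
    and F': "diassociative_algebra K F"
    using F unfolding free_dialgebra_def by (elim conjE exE) (rule that)
  note univ = univ0[THEN spec, THEN spec, THEN mp, OF conjI]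
  interpret F: diassociative_algebra K F by fact
  define s where "s = inv_into (carrier H) \<phi>"
  have s: "s y \<in> carrier H" "\<phi> (s y) = y" if "y \<in> carrier L" for y
    using that onto unfolding s_def by (auto intro: inv_into_into f_inv_into_f)
  have "(\<lambda>x. s (\<pi> x)) \<in> X \<rightarrow> carrier H" using s(1) dihomD(1)[OF \<pi>] X by auto
  then obtain g where g: "g \<in> dihom K F H" and gX: "\<And>x. x \<in> X \<Longrightarrow> g x = s (\<pi> x)"
    using univ[OF H] by blast
  \<comment> \<open>Uniqueness is applied to \<open>s \<circ> \<phi> \<circ> g\<close> and \<open>s \<circ> \<pi>\<close>, and \<open>s\<close> is cancelled.\<close>
  define T where "T = transported_dialgebra s \<phi> L"
  have T: "s \<in> dihom K L T" "diassociative_algebra K T"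
    unfolding T_def using transported_dialgebra[OF L, where r = \<phi> and s = s] s(2) by auto
  define a where "a = restrict (\<lambda>x. s (\<phi> (g x))) (carrier F)"
  define b where "b = restrict (\<lambda>x. s (\<pi> x)) (carrier F)"
  have a: "a \<in> dihom K F T \<inter> extensional (carrier F)"
    unfolding a_def by (auto intro!: F.dihom_restrict dihom_comp[OF dihom_comp[OF g \<phi>] T(1)])
  have b: "b \<in> dihom K F T \<inter> extensional (carrier F)"
    unfolding b_def by (auto intro!: F.dihom_restrict dihom_comp[OF \<pi> T(1)])
  have ab: "\<forall>x\<in>X. a x = b x"
    using X gX s(2) dihomD(1)[OF \<pi>] by (auto simp: a_def b_def subset_iff)
  have "b \<in> X \<rightarrow> carrier T" using b X dihomD(1)[of b K F T] by auto
  from univ[OF T(2) this] have "a = b" using a b ab by blast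
  have "\<phi> (g x) = \<pi> x" if x: "x \<in> carrier F" for x
  proof -
    have "s (\<phi> (g x)) = s (\<pi> x)" using fun_cong[OF \<open>a = b\<close>, of x] x by (simp add: a_def b_def)
    then show ?thesis using s(2) dihomD(1)[OF \<pi> x] dihomD(1)[OF \<phi> dihomD(1)[OF g x]] by metis
  qed
  then show ?thesis using that g by blast
qed


section \<open>The extension by the quotient of the derived algebra\<close>

text \<open>The construction of \<open>H\<close> makes sense for every extension \<open>F\<close> of a perfect algebra. Freeness of \<open>F\<close>
  enters only through the existence of a lift \<open>g\<close> of \<open>\<pi>\<close>.\<close>

locale perfect_extension =
  fixes K :: "('k, 'm) ring_scheme" and R :: "'f set" and F :: "('k, 'f, 'n) dialgebra_scheme"
    and \<pi> :: "'f \<Rightarrow> 'l" and L :: "('k, 'l, 'p) dialgebra_scheme"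
  assumes ext: "extension K R F \<pi> L" and perf: "perfect K L"
begin

sublocale F: diassociative_algebra K F using ext by (simp add: extension_def)
sublocale L: diassociative_algebra K L using ext by (simp add: extension_def)

definition I where "I = mutual_ideal K F R"
definition F' where "F' = derived_algebra K F"
definition H where "H = F\<lparr>carrier := F'\<rparr> DQuot I"

lemma pi: "\<pi> \<in> dihom K F L" "\<pi> ` carrier F = carrier L" and R_eq: "R = a_kernel F L \<pi>"
  using ext by (auto simp: extension_def)

lemma R_iff: "x \<in> R \<longleftrightarrow> x \<in> carrier F \<and> \<pi> x = \<zero>\<^bsub>L\<^esub>"
  by (simp add: R_eq a_kernel_def')

lemma R_diideal: "diideal K F R"
  unfolding R_eq by (rule kernel_diideal[OF pi(1) F.diassociative_algebra_axioms L.diassociative_algebra_axioms])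

lemma R_sub: "R \<subseteq> carrier F"
  using R_diideal by (simp add: diideal_def F.submodule_iff)

lemma F'_diideal: "diideal K F F'"
  unfolding F'_def by (rule F.derived_diideal)

lemma F'_sub: "F' \<subseteq> carrier F"
  using F'_diideal by (simp add: diideal_def F.submodule_iff)

lemma I_diideal: "diideal K F I"
  unfolding I_def by (rule F.mutual_ideal_diideal[OF R_diideal])

lemma I_sub: "I \<subseteq> F' \<inter> R"
proof -
  have "I \<subseteq> F'"
    unfolding I_def
  proof (rule F.mutual_ideal_least)
    show "submodule F' K F" using F'_diideal by (simp add: diideal_def)
    show "x \<stileturn>\<^bsub>F\<^esub> r \<in> F' \<and> x \<turnstile>\<^bsub>F\<^esub> r \<in> F' \<and> r \<stileturn>\<^bsub>F\<^esub> x \<in> F' \<and> r \<turnstile>\<^bsub>F\<^esub> x \<in> F'"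
      if "x \<in> carrier F" "r \<in> R" for x r
      using that R_sub unfolding F'_def derived_algebra_def by (auto intro: lozengeI)
  qed
  moreover have "I \<subseteq> R"
    unfolding I_def using R_diideal by (intro F.mutual_ideal_least) (auto simp: diideal_def)
  ultimately show ?thesis by blast
qed

sublocale F': diassociative_algebra K "F\<lparr>carrier := F'\<rparr>"
  by (rule F.ideal_diassociative[OF F'_diideal])

lemma I_diideal': "diideal K (F\<lparr>carrier := F'\<rparr>) I"
  using I_diideal I_sub F'_sub F.submodule_ideal_iff[OF F'_diideal, of I]
  by (auto simp: diideal_def)

sublocale H: diassociative_algebra K H
  unfolding H_def by (rule F'.quotient_diassociative[OF I_diideal'])

lemma coset_map: "(\<lambda>x. I +>\<^bsub>F\<^esub> x) \<in> dihom K (F\<lparr>carrier := F'\<rparr>) H"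
  using F'.coset_map_dihom[OF I_diideal'] unfolding H_def a_r_coset_carrier_update .

lemma H_carrier: "carrier H = (\<lambda>x. I +>\<^bsub>F\<^esub> x) ` F'"
  unfolding H_def quotient_carrier a_r_coset_carrier_update by simp

lemma factor:
  assumes "diassociative_algebra K E" "f \<in> dihom K F E" "\<And>j. j \<in> I \<Longrightarrow> f j = \<zero>\<^bsub>E\<^esub>"
  shows "x \<in> F' \<Longrightarrow> the_elem (f ` (I +>\<^bsub>F\<^esub> x)) = f x"
    and "(\<lambda>U. the_elem (f ` U)) \<in> dihom K H E"
  using F'.dihom_factor[OF I_diideal' assms(1) dihom_subalgebra[OF assms(2) F'_sub] assms(3)]
  unfolding H_def a_r_coset_carrier_update by simp_all

lemma pi_factor:
  shows "x \<in> F' \<Longrightarrow> the_elem (\<pi> ` (I +>\<^bsub>F\<^esub> x)) = \<pi> x"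
    and "(\<lambda>U. the_elem (\<pi> ` U)) \<in> dihom K H L"
proof -
  have van: "\<pi> j = \<zero>\<^bsub>L\<^esub>" if "j \<in> I" for j using that I_sub R_iff by blast
  show "x \<in> F' \<Longrightarrow> the_elem (\<pi> ` (I +>\<^bsub>F\<^esub> x)) = \<pi> x"
    and "(\<lambda>U. the_elem (\<pi> ` U)) \<in> dihom K H L"
    using factor[OF L.diassociative_algebra_axioms pi(1) van] by simp_all
qed

lemma pi_F': "\<pi> ` F' = carrier L"
  unfolding F'_def
  by (rule derived_onto_perfect[OF pi(1) F.diassociative_algebra_axioms L.module_axioms pi(2) perf])

lemma kernel_carrier:
  "carrier (F\<lparr>carrier := F' \<inter> R\<rparr> DQuot I) = (\<lambda>x. I +>\<^bsub>F\<^esub> x) ` (F' \<inter> R)"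
  unfolding quotient_carrier a_r_coset_carrier_update by simp

text \<open>A product with a factor in \<open>R\<close> lies in \<open>I\<close>, so the kernel is central.\<close>

lemma H_central_extension:
  "central_extension K (carrier (F\<lparr>carrier := F' \<inter> R\<rparr> DQuot I)) H (\<lambda>U. the_elem (\<pi> ` U)) L"
proof -
  have onto: "(\<lambda>U. the_elem (\<pi> ` U)) ` carrier H = carrier L"
    unfolding H_carrier image_image using pi_F' pi_factor(1) by simp
  have ker: "carrier (F\<lparr>carrier := F' \<inter> R\<rparr> DQuot I) = a_kernel H L (\<lambda>U. the_elem (\<pi> ` U))"
    unfolding kernel_carrier a_kernel_def' H_carrier
    using pi_factor(1) F'_sub by (auto simp: R_iff a_kernel_def')
  have zero: "\<zero>\<^bsub>H\<^esub> = I" by (simp add: H_def quotient_zero)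
  have "I +>\<^bsub>F\<^esub> a \<in> center H" if a: "a \<in> F'" "a \<in> R" for a
  proof -
    have "I +>\<^bsub>F\<^esub> (x \<stileturn>\<^bsub>F\<^esub> a) = I" "I +>\<^bsub>F\<^esub> (x \<turnstile>\<^bsub>F\<^esub> a) = I"
      "I +>\<^bsub>F\<^esub> (a \<stileturn>\<^bsub>F\<^esub> x) = I" "I +>\<^bsub>F\<^esub> (a \<turnstile>\<^bsub>F\<^esub> x) = I" if "x \<in> F'" for x
      using F.mutual_idealI[OF R_sub _ a(2), of x] that F'_sub F.coset_eq_ideal[OF I_diideal]
      by (auto simp: I_def[symmetric])
    then show ?thesis
      using a dihomD(3,4)[OF coset_map, symmetric] by (auto simp: center_def H_carrier zero)
  qed
  then have "carrier (F\<lparr>carrier := F' \<inter> R\<rparr> DQuot I) \<subseteq> center H"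
    unfolding kernel_carrier by blast
  then show ?thesis
    unfolding central_extension_def extension_def
    by (intro conjI H.diassociative_algebra_axioms L.diassociative_algebra_axioms pi_factor(2) onto ker)
qed

text \<open>For \<open>r, r' \<in> R\<close> and \<open>a, b \<in> F'\<close>, the products \<open>(r + a) \<star> (r' + b)\<close> and \<open>a \<star> b\<close> are congruent
  modulo \<open>I\<close>, and such sums \<open>r + a\<close> exhaust \<open>F\<close>.\<close>

lemma H_perfect: "perfect K H"
proof -
  have der: "submodule (derived_algebra K H) K H"
    using H.derived_diideal by (simp add: diideal_def)
  \<comment> \<open>The elements of \<open>F'\<close> whose class is in the derived algebra of \<open>H\<close>. They form a submodule
    of \<open>F\<close>, so \<open>F' \<subseteq> N\<close> can be tested on products.\<close>
  define N where "N = {x \<in> F'. I +>\<^bsub>F\<^esub> x \<in> derived_algebra K H}"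
  have "submodule N K (F\<lparr>carrier := F'\<rparr>)"
    unfolding N_def using dihom_vimage_submodule[OF coset_map F'.module_axioms H.module_axioms der] by simp
  then have N: "submodule N K F" using F.submodule_ideal_iff[OF F'_diideal] by blast
  have decomp: "\<exists>r\<in>R. \<exists>a\<in>F'. x = r \<oplus>\<^bsub>F\<^esub> a" if x: "x \<in> carrier F" for x
  proof -
    have "\<pi> x \<in> \<pi> ` F'" using pi_F' dihomD(1)[OF pi(1) x] by simp
    then obtain a where a: "a \<in> F'" "\<pi> x = \<pi> a" by blast
    then show ?thesis
      using same_image_differ_by_kernel[OF pi(1) F.module_axioms L.module_axioms x _ a(2)] F'_sub R_eq
      by blast
  qed
  have key: "p (r \<oplus>\<^bsub>F\<^esub> a) (r' \<oplus>\<^bsub>F\<^esub> b) \<in> N"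
    if p: "bilinear_product K F p" and ab: "p a b \<in> N"
      and c: "\<And>x r. x \<in> carrier F \<Longrightarrow> r \<in> R \<Longrightarrow> p x r \<in> I \<and> p r x \<in> I"
      and r: "r \<in> R" "r' \<in> R" and a: "a \<in> F'" "b \<in> F'" for p r a r' b
  proof -
    have car: "r \<in> carrier F" "r' \<in> carrier F" "a \<in> carrier F" "b \<in> carrier F"
      using r a R_sub F'_sub by auto
    have "I \<subseteq> N"
    proof
      fix j assume j: "j \<in> I"
      then have "I +>\<^bsub>F\<^esub> j = \<zero>\<^bsub>H\<^esub>" by (simp add: F.coset_eq_ideal[OF I_diideal] H_def quotient_zero)
      then show "j \<in> N" using j I_sub der by (auto simp: N_def H.submodule_iff)
    qed
    moreover have "p r r' \<in> I" "p r b \<in> I" "p a r' \<in> I" using c r car by auto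
    moreover have "p (r \<oplus>\<^bsub>F\<^esub> a) (r' \<oplus>\<^bsub>F\<^esub> b) = (p r r' \<oplus>\<^bsub>F\<^esub> p r b) \<oplus>\<^bsub>F\<^esub> (p a r' \<oplus>\<^bsub>F\<^esub> p a b)"
      using car by (simp add: bilinear_productD[OF p] F.M.a_ac)
    moreover have "u \<oplus>\<^bsub>F\<^esub> v \<in> N" if "u \<in> N" "v \<in> N" for u v
      using that N by (simp add: F.submodule_iff)
    ultimately show ?thesis using ab by (simp add: subset_iff)
  qed
  have "F' \<subseteq> N"
    unfolding F'_def derived_algebra_def
  proof (rule lozenge_least[OF N])
    fix x y assume x: "x \<in> carrier F" and y: "y \<in> carrier F"
    obtain r a where ra: "r \<in> R" "a \<in> F'" "x = r \<oplus>\<^bsub>F\<^esub> a" using decomp[OF x] by blast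
    obtain r' b where rb: "r' \<in> R" "b \<in> F'" "y = r' \<oplus>\<^bsub>F\<^esub> b" using decomp[OF y] by blast
    have gen: "c \<stileturn>\<^bsub>F\<^esub> r \<in> I \<and> r \<stileturn>\<^bsub>F\<^esub> c \<in> I" "c \<turnstile>\<^bsub>F\<^esub> r \<in> I \<and> r \<turnstile>\<^bsub>F\<^esub> c \<in> I"
      if "c \<in> carrier F" "r \<in> R" for c r
      using F.mutual_idealI[OF R_sub that] by (simp_all add: I_def)
    have "I +>\<^bsub>F\<^esub> a \<in> carrier H" "I +>\<^bsub>F\<^esub> b \<in> carrier H" using ra rb by (auto simp: H_carrier)
    then have "a \<stileturn>\<^bsub>F\<^esub> b \<in> N" "a \<turnstile>\<^bsub>F\<^esub> b \<in> N"
      using ra rb dihomD(3,4)[OF coset_map, of a b] F'_diideal F'_sub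
      unfolding N_def derived_algebra_def[of K H] by (auto intro: lozengeI simp: diideal_def)
    then show "x \<stileturn>\<^bsub>F\<^esub> y \<in> N \<and> x \<turnstile>\<^bsub>F\<^esub> y \<in> N"
      unfolding ra(3) rb(3) using ra rb gen
      by (auto intro!: key F.lprod_bilinear F.rprod_bilinear)
  qed
  then have "carrier H \<subseteq> derived_algebra K H" by (auto simp: H_carrier N_def)
  moreover have "derived_algebra K H \<subseteq> carrier H" using der by (simp add: H.submodule_iff)
  ultimately show ?thesis by (simp add: perfect_def)
qed

text \<open>A lift of \<open>\<pi>\<close> maps \<open>R\<close> into \<open>A1\<close>, hence into the center of \<open>H1\<close>.\<close>

lemma lift_vanishes:
  assumes E1: "central_extension K A1 H1 \<phi>1 L"
    and g: "g \<in> dihom K F H1" "\<And>x. x \<in> carrier F \<Longrightarrow> \<phi>1 (g x) = \<pi> x"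
  shows "j \<in> I \<Longrightarrow> g j = \<zero>\<^bsub>H1\<^esub>"
proof -
  interpret H1: diassociative_algebra K H1 using E1 by (simp add: central_extension_def extension_def)
  have cent: "g r \<in> center H1" if "r \<in> R" for r
    using that E1 g R_sub dihomD(1)[OF g(1)]
    by (auto simp: central_extension_def extension_def R_iff a_kernel_def')
  have "I \<subseteq> a_kernel F H1 g"
    unfolding I_def
  proof (rule F.mutual_ideal_least)
    show "submodule (a_kernel F H1 g) K F"
      using kernel_diideal[OF g(1) F.diassociative_algebra_axioms H1.diassociative_algebra_axioms]
      by (simp add: diideal_def)
    fix x r assume x: "x \<in> carrier F" and r: "r \<in> R"
    then have rc: "r \<in> carrier F" using R_sub by auto
    show "x \<stileturn>\<^bsub>F\<^esub> r \<in> a_kernel F H1 g \<and> x \<turnstile>\<^bsub>F\<^esub> r \<in> a_kernel F H1 g \<and>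
      r \<stileturn>\<^bsub>F\<^esub> x \<in> a_kernel F H1 g \<and> r \<turnstile>\<^bsub>F\<^esub> x \<in> a_kernel F H1 g"
      using x rc cent[OF r] dihomD(1,3,4)[OF g(1)]
        bilinear_productD(1)[OF F.lprod_bilinear] bilinear_productD(1)[OF F.rprod_bilinear]
      by (auto simp: a_kernel_def' center_def)
  qed
  then show "j \<in> I \<Longrightarrow> g j = \<zero>\<^bsub>H1\<^esub>" by (auto simp: a_kernel_def')
qed

lemma lift_covering_map:
  assumes E1: "central_extension K A1 H1 \<phi>1 L"
    and g: "g \<in> dihom K F H1" "\<And>x. x \<in> carrier F \<Longrightarrow> \<phi>1 (g x) = \<pi> x"
  shows "restrict (\<lambda>U. the_elem (g ` U)) (carrier H) \<in>
    covering_maps K (carrier (F\<lparr>carrier := F' \<inter> R\<rparr> DQuot I)) H (\<lambda>U. the_elem (\<pi> ` U)) A1 H1 \<phi>1"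
proof -
  have H1: "diassociative_algebra K H1" and A1: "A1 = a_kernel H1 L \<phi>1"
    using E1 by (simp_all add: central_extension_def extension_def)
  have fac: "\<And>x. x \<in> F' \<Longrightarrow> the_elem (g ` (I +>\<^bsub>F\<^esub> x)) = g x"
    "(\<lambda>U. the_elem (g ` U)) \<in> dihom K H H1"
    using factor[OF H1 g(1) lift_vanishes[OF E1 g]] by blast+
  show ?thesis
    unfolding covering_maps_def
    using H.dihom_restrict[OF fac(2)] fac(1) g pi_factor(1) F'_sub dihomD(1)[OF g(1)]
    by (auto simp: kernel_carrier H_carrier A1 a_kernel_def' R_iff subset_iff)
qed

end


section \<open>Universality\<close>

theorem theorem3p3:
  fixes K :: "('k, 'm) ring_scheme"
    and L :: "('k, 'l) dialgebra"
    and F :: "('k, 'f) dialgebra"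
    and R :: "'f set"
    and \<pi> :: "'f \<Rightarrow> 'l"
  assumes "diassociative_algebra K L"
    and "finite_dimensional K L"
    and "perfect K L"
    and "free_presentation TYPE('h) K R F \<pi> L"
  shows "let F' = derived_algebra K F;
             I = lozenge K F (carrier F) R <+>\<^bsub>F\<^esub> lozenge K F R (carrier F)
         in universal_extension TYPE('h) K
              (carrier (F\<lparr>carrier := F' \<inter> R\<rparr> DQuot I))
              (F\<lparr>carrier := F'\<rparr> DQuot I)
              (\<lambda>U. the_elem (\<pi> ` U))
              L"
proof -
  interpret P: perfect_extension K R F \<pi> L
    using assms(3,4) by unfold_locales (simp_all add: free_presentation_def)
  have free: "free_dialgebra TYPE('h) K F" using assms(4) by (simp add: free_presentation_def)
  have "uniquely_covers K (carrier (F\<lparr>carrier := P.F' \<inter> R\<rparr> DQuot P.I)) P.H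
      (\<lambda>U. the_elem (\<pi> ` U)) A1 H1 \<phi>1"
    if E1: "central_extension K A1 H1 \<phi>1 L"
    for A1 :: "'h set" and H1 :: "('k, 'h) dialgebra" and \<phi>1
  proof -
    have H1: "diassociative_algebra K H1" and \<phi>1: "\<phi>1 \<in> dihom K H1 L" "\<phi>1 ` carrier H1 = carrier L"
      using E1 by (simp_all add: central_extension_def extension_def)
    obtain g where "g \<in> dihom K F H1" "\<And>x. x \<in> carrier F \<Longrightarrow> \<phi>1 (g x) = \<pi> x"
      using free_dialgebra_lift[OF free H1 P.L.diassociative_algebra_axioms \<phi>1 P.pi(1)] by blast
    from P.lift_covering_map[OF E1 this] show ?thesis
      unfolding uniquely_covers_def
      using covering_maps_unique[OF P.H.diassociative_algebra_axioms P.H_perfect E1] by blast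
  qed
  then show ?thesis
    using P.H_central_extension
    unfolding Let_def universal_extension_def P.H_def P.F'_def P.I_def mutual_ideal_def by blast
qed

end
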